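(* Let $F^*=\min_{x\in\operatorname{dom}\psi}[F(x):=f(x)+\psi(x)]$ be the composite convex problem described in the context. Suppose that $D>0$ satisfies $\|x-y\|\le D$ for all $x,y\in\operatorname{dom}\psi$, and that the Hölder constant $L_\nu$ of $f$ is finite for at least one $\nu\in[0,1]$. Let $(x_k)_{k\ge 0}$ be generated by the Universal Line-Search-Free Gradient Method (defined in the context), and for $k\ge 1$ let $x_k^*$ be the best iterate, i.e. a point of $\{x_1,\ldots,x_k\}$ with the smallest value of $F$. Then, for all $k\ge 1$, $$F(x_k^* )-F^*\le \inf_{\nu\in[0,1]}\frac{2L_\nu D^{1+\nu}}{k^{(1+\nu)/2}}.$$ Consequently, for any $\epsilon>0$, to reach $F(x_k^* )-F^*\le\epsilon$ it suffices to make $$\inf_{\nu\in[0,1]}\Bigl[\frac{2L_\nu}{\epsilon}\Bigr]^{2/(1+\nu)}D^2$$ iterations (that is, it suffices that the integer $k\ge1$ is at least this number).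
   Context: Norms: $\mathbb{R}^n$ carries the standard inner product $\langle\cdot,\cdot\rangle$, the norm $\|x\|=\langle Bx,x\rangle^{1/2}$ for a fixed symmetric positive definite matrix $B$, and the dual norm $\|s\|_*=\langle s,B^{-1}s\rangle^{1/2}$. Problem: $\psi:\mathbb{R}^n\to\mathbb{R}\cup\{+\infty\}$ is a proper closed convex function; $f:\mathbb{R}^n\to\mathbb{R}\cup\{+\infty\}$ is a closed convex function which is finite and subdifferentiable over an open set containing $\operatorname{dom}\psi=\{x:\psi(x)<+\infty\}$. Hölder constants: for $\nu\in[0,1]$, $$L_\nu:=\sup\Bigl\{\frac{\|g(x)-g(y)\|_*}{\|x-y\|^\nu}: x,y\in\operatorname{dom}\psi,\ x\ne y,\ g(x)\in\partial f(x),\ g(y)\in\partial f(y)\Bigr\}\in[0,+\infty].$$ Terms with $L_\nu=+\infty$ are interpreted as $+\infty$ in the infima. Notation: $[t]_+=\max\{t,0\}$. Universal Line-Search-Free Gradient Method: choose $x_0\in\operatorname{dom}\psi$, set $H_0:=0$. For $k=0,1,\ldots$: 1. compute some $g_k\in\partial f(x_k)$; 2. let $x_{k+1}$ be a solution (an arbitrary one if it is not unique) of $\min_{x\in\operatorname{dom}\psi}\{\langle g_k,x\rangle+\psi(x)+\frac{H_k}{2}\|x-x_k\|^2\}$; 3. set $$H_{k+1}:=H_k+\frac{[\beta_{k+1}-\frac12H_kr_{k+1}^2]_+}{D^2+\frac12r_{k+1}^2},$$ where $r_{k+1}:=\|x_k-x_{k+1}\|$ and $\beta_{k+1}:=f(x_{k+1})-f(x_k)-\langle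 g_k,x_{k+1}-x_k\rangle$. *)

theory Defs
  imports "HOL-Analysis.Analysis"
begin

definition spd_matrix :: "real^'n^'n \<Rightarrow> bool" where
  "spd_matrix B \<longleftrightarrow> transpose B = B \<and> (\<forall>x. x \<noteq> 0 \<longrightarrow> (B *v x) \<bullet> x > 0)"

definition primal_norm :: "real^'n^'n \<Rightarrow> real^'n \<Rightarrow> real" where
  "primal_norm B x = sqrt ((B *v x) \<bullet> x)"

definition dual_norm :: "real^'n^'n \<Rightarrow> real^'n \<Rightarrow> real" where
  "dual_norm B s = sqrt (s \<bullet> (matrix_inv B *v s))"

text \<open>
  Functions with values in the reals extended by \<open>+\<infinity>\<close> are modelled as \<open>ereal\<close>-valued functions
  that never take the value \<open>-\<infinity>\<close>. "Closed convex" means that the epigraph, a subset of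
  \<open>real^'n \<times> real\<close>, is closed and convex; the library's \<open>epigraph\<close> only covers real-valued
  functions.
\<close>

definition eff_dom :: "(real^'n \<Rightarrow> ereal) \<Rightarrow> (real^'n) set" where
  "eff_dom f = {x. f x < \<infinity>}"

definition closed_convex_fun :: "(real^'n \<Rightarrow> ereal) \<Rightarrow> bool" where
  "closed_convex_fun f \<longleftrightarrow>
     (\<forall>x. f x \<noteq> -\<infinity>) \<and>
     closed {(x, t::real). f x \<le> ereal t} \<and> convex {(x, t::real). f x \<le> ereal t}"

definition proper_fun :: "(real^'n \<Rightarrow> ereal) \<Rightarrow> bool" where
  "proper_fun f \<longleftrightarrow> (\<forall>x. f x \<noteq> -\<infinity>) \<and> (\<exists>x. f x < \<infinity>)"

text \<open>The subdifferential is empty outside the effective domain.\<close>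

definition subdiff :: "(real^'n \<Rightarrow> ereal) \<Rightarrow> real^'n \<Rightarrow> (real^'n) set" where
  "subdiff f x = {g. x \<in> eff_dom f \<and> (\<forall>y. f y \<ge> f x + ereal (g \<bullet> (y - x)))}"

text \<open>
  The supremum is taken in \<open>[0, \<infinity>]\<close>, so it is \<open>0\<close> when \<open>S\<close> has at most one point.
  Since \<open>x \<noteq> y\<close>, the denominator is positive, and it is \<open>1\<close> for \<open>\<nu> = 0\<close>.
\<close>

definition hoelder_const ::
    "real^'n^'n \<Rightarrow> (real^'n \<Rightarrow> ereal) \<Rightarrow> (real^'n) set \<Rightarrow> real \<Rightarrow> ennreal" where
  "hoelder_const B f S \<nu> =
     Sup {ennreal (dual_norm B (gx - gy) / primal_norm B (x - y) powr \<nu>) | x y gx gy.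
            x \<in> S \<and> y \<in> S \<and> x \<noteq> y \<and> gx \<in> subdiff f x \<and> gy \<in> subdiff f y}"

text \<open>Real powers on \<open>[0, \<infinity>]\<close>; meaningful for positive exponents only.\<close>

definition ennreal_powr :: "ennreal \<Rightarrow> real \<Rightarrow> ennreal" where
  "ennreal_powr a p = (if a = \<infinity> then \<infinity> else ennreal (enn2real a powr p))"

definition composite :: "(real^'n \<Rightarrow> ereal) \<Rightarrow> (real^'n \<Rightarrow> ereal) \<Rightarrow> real^'n \<Rightarrow> ereal" where
  "composite f \<psi> x = f x + \<psi> x"

text \<open>
  The optimal value is written as an infimum, so that no existence of a minimizer has to be assumed.
  It is attained whenever \<open>f\<close> and \<open>\<psi>\<close> are closed convex, \<open>\<psi>\<close> is proper with bounded effective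
  domain and \<open>f\<close> is finite on that domain.
\<close>

definition opt_value :: "(real^'n \<Rightarrow> ereal) \<Rightarrow> (real^'n \<Rightarrow> ereal) \<Rightarrow> ereal" where
  "opt_value f \<psi> = (INF x\<in>eff_dom \<psi>. composite f \<psi> x)"

text \<open>
  \<open>x\<close>, \<open>g\<close>, \<open>H\<close> are the iterates, subgradients and step coefficients of one run, for arbitrary
  choices of the subgradient and of the solution of the subproblem. All values of \<open>f\<close> passed to
  \<open>real_of_ereal\<close> are finite, because the iterates lie in \<open>eff_dom \<psi>\<close>, where \<open>f\<close> is finite.
\<close>

definition bregman_gap :: "(real^'n \<Rightarrow> ereal) \<Rightarrow> real^'n \<Rightarrow> real^'n \<Rightarrow> real^'n \<Rightarrow> real" where
  "bregman_gap f g x y = real_of_ereal (f y) - real_of_ereal (f x) - g \<bullet> (y - x)"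

definition line_search_free_run ::
    "real^'n^'n \<Rightarrow> (real^'n \<Rightarrow> ereal) \<Rightarrow> (real^'n \<Rightarrow> ereal) \<Rightarrow> real \<Rightarrow>
     (nat \<Rightarrow> real^'n) \<Rightarrow> (nat \<Rightarrow> real^'n) \<Rightarrow> (nat \<Rightarrow> real) \<Rightarrow> bool" where
  "line_search_free_run B f \<psi> D x g H \<longleftrightarrow>
     x 0 \<in> eff_dom \<psi> \<and> H 0 = 0 \<and>
     (\<forall>k. g k \<in> subdiff f (x k) \<and>
          is_arg_min
            (\<lambda>y. ereal (g k \<bullet> y) + \<psi> y + ereal (H k / 2 * (primal_norm B (y - x k))\<^sup>2))
            (\<lambda>y. y \<in> eff_dom \<psi>) (x (Suc k)) \<and>
          (let r = primal_norm B (x k - x (Suc k));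
               \<beta> = bregman_gap f (g k) (x k) (x (Suc k))
           in H (Suc k) = H k + max (\<beta> - H k * r\<^sup>2 / 2) 0 / (D\<^sup>2 + r\<^sup>2 / 2)))"

definition best_iterate ::
    "(real^'n \<Rightarrow> ereal) \<Rightarrow> (nat \<Rightarrow> real^'n) \<Rightarrow> nat \<Rightarrow> real^'n \<Rightarrow> bool" where
  "best_iterate F x k z \<longleftrightarrow> is_arg_min F (\<lambda>y. y \<in> x ` {1..k}) z"

end

theory Submission
  imports Defs
begin

text \<open>
  Combining the strong convexity of the subproblem with the definition of \<open>H\<^sub>k\<^sub>+\<^sub>1\<close> gives, for every
  \<open>y\<close> in the domain, a recursion for \<open>F(x\<^sub>k\<^sub>+\<^sub>1) - F(y) + H\<^sub>k\<^sub>+\<^sub>1/2 \<parallel>x\<^sub>k\<^sub>+\<^sub>1 - y\<parallel>\<^sup>2\<close> whose error term is at most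
  \<open>2 D\<^sup>2 (H\<^sub>k\<^sub>+\<^sub>1 - H\<^sub>k)\<close>; it telescopes to \<open>F(x\<^sub>k\<^sup>*) - F\<^sup>* \<le> 2 H\<^sub>k D\<^sup>2 / k\<close>. Since
  \<open>\<beta>\<^sub>k\<^sub>+\<^sub>1 \<le> L\<^sub>\<nu> r\<^sub>k\<^sub>+\<^sub>1\<^sup>1\<^sup>+\<^sup>\<nu> / (1 + \<nu>)\<close>, the coefficients cannot grow faster than
  \<open>H\<^sub>k \<le> L\<^sub>\<nu> k\<^bsup>(1-\<nu>)/2\<^esup> / D\<^bsup>1-\<nu>\<^esup>\<close>, which yields the rate for each \<open>\<nu>\<close> separately.
\<close>

section \<open>Real powers\<close>

text \<open>\<open>Youngs_inequality_0\<close> handles positive bases. If a base vanishes, so does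
  the left side, because \<open>0 powr \<alpha> = 0\<close> even for \<alpha> = 0.\<close>

lemma weighted_am_gm:
  fixes a b \<alpha> :: real
  assumes "0 \<le> a" "0 \<le> b" "0 \<le> \<alpha>" "\<alpha> \<le> 1"
  shows "a powr \<alpha> * b powr (1 - \<alpha>) \<le> \<alpha> * a + (1 - \<alpha>) * b"
  using assms Youngs_inequality_0[of \<alpha> "1 - \<alpha>" a b]
  by (cases "a = 0"; cases "b = 0") auto

text \<open>The tangent at 1 of a concave power. It serves twice in
  \<open>step_coefficient_bound\<close>: for the ratio k / (k + 1) and for the rescaled squared
  step.\<close>

lemma powr_le_affine:
  fixes s q :: real
  assumes "0 \<le> s" "0 \<le> q" "q \<le> 1"
  shows "s powr q \<le> q * s + (1 - q)"
  using weighted_am_gm[of s 1 q] assms by simp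

text \<open>A convex power lies above its tangent at u. Weighted AM-GM with weights 1 / (1 + \<nu>)
  and \<nu> / (1 + \<nu>) replaces differentiation, so u = 0 is included.\<close>

lemma powr_tangent_below:
  fixes t u \<nu> :: real
  assumes "0 \<le> u" "0 \<le> t" "0 \<le> \<nu>"
  shows "(1 + \<nu>) * (t - u) * u powr \<nu> \<le> t powr (1 + \<nu>) - u powr (1 + \<nu>)"
proof -
  have "t * u powr \<nu> \<le> 1 / (1 + \<nu>) * t powr (1 + \<nu>) + (1 - 1 / (1 + \<nu>)) * u powr (1 + \<nu>)"
    using weighted_am_gm[of "t powr (1 + \<nu>)" "u powr (1 + \<nu>)" "1 / (1 + \<nu>)"] assms
    by (simp add: powr_powr algebra_simps flip: add_divide_distrib)
  then have "(1 + \<nu>) * (t * u powr \<nu>) \<le>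
      (1 + \<nu>) * (1 / (1 + \<nu>) * t powr (1 + \<nu>) + (1 - 1 / (1 + \<nu>)) * u powr (1 + \<nu>))"
    using assms by (intro mult_left_mono) auto
  also have "\<dots> = t powr (1 + \<nu>) + \<nu> * u powr (1 + \<nu>)"
    using assms by (simp add: divide_simps)
  finally show ?thesis
    using assms by (simp add: powr_add algebra_simps)
qed

text \<open>
  Replaces \<open>\<integral>\<^sub>0\<^sup>1 C t\<^sup>\<nu> dt\<close> by Riemann sums: the error of the right-endpoint sum telescopes and is
  at most \<open>C / n\<close>.
\<close>
lemma hoelder_line_bound:
  fixes \<phi> s :: "real \<Rightarrow> real" and C \<nu> :: real
  assumes sub: "\<And>t u. t \<in> {0..1} \<Longrightarrow> u \<in> {0..1} \<Longrightarrow> \<phi> t + s t * (u - t) \<le> \<phi> u"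
    and hoelder: "\<And>t. t \<in> {0<..1} \<Longrightarrow> s t - s 0 \<le> C * t powr \<nu>"
    and "0 \<le> C" "0 \<le> \<nu>"
  shows "\<phi> 1 - \<phi> 0 - s 0 \<le> C / (1 + \<nu>)"
proof -
  have cancel: "C / (1 + \<nu>) * ((1 + \<nu>) * d * e) = C * d * e" for d e
    using \<open>0 \<le> \<nu>\<close> by simp
  have approx: "\<phi> 1 - \<phi> 0 - s 0 \<le> C / (1 + \<nu>) + C / real n" if "n > 0" for n :: nat
  proof -
    define p where "p i = real i / real n" for i
    have step: "\<phi> (p (Suc i)) - \<phi> (p i) \<le> s 0 / real n
        + C / (1 + \<nu>) * (p (Suc i) powr (1 + \<nu>) - p i powr (1 + \<nu>))
        + C / real n * (p (Suc i) powr \<nu> - p i powr \<nu>)" if "i < n" for i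
    proof -
      have p: "p i \<in> {0..1}" "p (Suc i) \<in> {0<..1}" "p (Suc i) - p i = 1 / real n"
        using that \<open>n > 0\<close> by (auto simp: p_def field_simps)
      \<comment> \<open>The slope at the right endpoint bounds the increment from above: apply
        \<open>sub\<close> at \<open>p (Suc i)\<close> and look back to \<open>p i\<close>.\<close>
      have "\<phi> (p (Suc i)) - \<phi> (p i) \<le> s (p (Suc i)) * (p (Suc i) - p i)"
        using sub[of "p (Suc i)" "p i"] p(1,2) by (simp add: algebra_simps)
      also have "\<dots> \<le> (s 0 + C * p (Suc i) powr \<nu>) * (1 / real n)"
        unfolding p(3) using hoelder[OF p(2)] by (intro mult_right_mono) auto
      \<comment> \<open>The power is split into its left-endpoint value, controlled by the tangent
        inequality, and a difference that telescopes.\<close>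
      also have "\<dots> = s 0 / real n + C / (1 + \<nu>) * ((1 + \<nu>) * (p (Suc i) - p i) * p i powr \<nu>)
          + C / real n * (p (Suc i) powr \<nu> - p i powr \<nu>)"
        unfolding cancel p(3) by (simp add: algebra_simps add_divide_distrib diff_divide_distrib)
      also have "\<dots> \<le> s 0 / real n + C / (1 + \<nu>) * (p (Suc i) powr (1 + \<nu>) - p i powr (1 + \<nu>))
          + C / real n * (p (Suc i) powr \<nu> - p i powr \<nu>)"
        using p assms(3,4)
        by (intro add_mono mult_left_mono powr_tangent_below order_refl) auto
      finally show ?thesis .
    qed
    have "\<phi> (p n) - \<phi> (p 0) = (\<Sum>i<n. \<phi> (p (Suc i)) - \<phi> (p i))"
      using sum_lessThan_telescope[of "\<lambda>i. \<phi> (p i)" n] by simp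
    also have "\<dots> \<le> (\<Sum>i<n. s 0 / real n
        + C / (1 + \<nu>) * (p (Suc i) powr (1 + \<nu>) - p i powr (1 + \<nu>))
        + C / real n * (p (Suc i) powr \<nu> - p i powr \<nu>))"
      by (intro sum_mono step) auto
    also have "\<dots> = real n * (s 0 / real n)
        + C / (1 + \<nu>) * (p n powr (1 + \<nu>) - p 0 powr (1 + \<nu>))
        + C / real n * (p n powr \<nu> - p 0 powr \<nu>)"
      using sum_lessThan_telescope[of "\<lambda>i. p i powr (1 + \<nu>)" n]
        sum_lessThan_telescope[of "\<lambda>i. p i powr \<nu>" n]
      by (simp only: sum.distrib sum_constant card_lessThan flip: sum_distrib_left)
    \<comment> \<open>Here \<open>p n = 1\<close> and \<open>p 0 = 0\<close>. Since
      \<open>0 powr \<nu> = 0\<close> also for \<nu> = 0, both telescoped differences are 1.\<close>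
    finally show ?thesis
      using \<open>n > 0\<close> by (simp add: p_def)
  qed
  have "(\<lambda>n. C / (1 + \<nu>) + C / real n) \<longlonglongrightarrow> C / (1 + \<nu>) + 0"
    by (intro tendsto_intros lim_const_over_n)
  then show ?thesis
    by (intro LIMSEQ_le_const[of _ "C / (1 + \<nu>)"]) (use approx in \<open>auto intro!: exI[of _ 1]\<close>)
qed

section \<open>Primal and dual norms\<close>

lemma spd_matrix_sym:
  assumes "spd_matrix B"
  shows "(B *v u) \<bullet> v = (B *v v) \<bullet> u"
  using assms dot_lmul_matrix[of u B v]
  by (metis spd_matrix_def inner_commute transpose_matrix_vector)

lemma spd_matrix_nonneg:
  assumes "spd_matrix B"
  shows "0 \<le> (B *v u) \<bullet> u"
  using assms by (cases "u = 0") (auto simp: spd_matrix_def less_imp_le)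

lemma primal_norm_nonneg: "spd_matrix B \<Longrightarrow> 0 \<le> primal_norm B u"
  by (simp add: primal_norm_def spd_matrix_nonneg)

lemma primal_norm_power2: "spd_matrix B \<Longrightarrow> (primal_norm B u)\<^sup>2 = (B *v u) \<bullet> u"
  by (simp add: primal_norm_def spd_matrix_nonneg)

lemma primal_norm_minus_commute: "primal_norm B (u - v) = primal_norm B (v - u)"
  by (simp add: primal_norm_def matrix_vector_mult_diff_distrib algebra_simps)

lemma primal_norm_scaleR:
  "primal_norm B (t *\<^sub>R u) = \<bar>t\<bar> * primal_norm B u"
  by (simp add: primal_norm_def matrix_vector_mult_scaleR real_sqrt_mult flip: mult.assoc)

text \<open>The last term is the exact strong convexity gain; it produces the additional quadratic
  term in \<open>prox_inequality\<close>.\<close>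

lemma primal_norm_convex_combination:
  assumes "spd_matrix B"
  shows "(primal_norm B ((1 - t) *\<^sub>R u + t *\<^sub>R v))\<^sup>2 =
    (1 - t) * (primal_norm B u)\<^sup>2 + t * (primal_norm B v)\<^sup>2 - t * (1 - t) * (primal_norm B (v - u))\<^sup>2"
  unfolding primal_norm_power2[OF assms]
  using spd_matrix_sym[OF assms, of u v]
  by (simp add: matrix_vector_right_distrib matrix_vector_mult_diff_distrib
      matrix_vector_mult_scaleR algebra_simps inner_add_left inner_diff_left)

lemma spd_matrix_Cauchy_Schwarz:
  assumes "spd_matrix B"
  shows "(B *v w) \<bullet> v \<le> primal_norm B w * primal_norm B v"
proof (cases "v = 0")
  case False
  define b where "b = (B *v v) \<bullet> v"
  define c where "c = (B *v w) \<bullet> v"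
  have b: "b > 0"
    using assms False by (auto simp: spd_matrix_def b_def)
  \<comment> \<open>The factor c / b minimises the squared norm of w - t v over t.\<close>
  have "0 \<le> (B *v (w - (c / b) *\<^sub>R v)) \<bullet> (w - (c / b) *\<^sub>R v)"
    by (rule spd_matrix_nonneg[OF assms])
  also have "\<dots> = (B *v w) \<bullet> w - 2 * (c / b) * c + (c / b) * (c / b) * b"
    using spd_matrix_sym[OF assms, of v w]
    by (simp add: matrix_vector_mult_diff_distrib matrix_vector_mult_scaleR inner_diff_left
        algebra_simps b_def c_def)
  also have "\<dots> = (B *v w) \<bullet> w - c\<^sup>2 / b"
    using b by (simp add: field_simps power2_eq_square)
  finally have "c\<^sup>2 \<le> ((B *v w) \<bullet> w) * b"
    using b by (simp add: field_simps)
  also have "\<dots> = (primal_norm B w * primal_norm B v)\<^sup>2"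
    by (simp add: power_mult_distrib primal_norm_power2[OF assms] b_def)
  finally show ?thesis
    unfolding c_def by (rule power2_le_imp_le) (simp add: primal_norm_nonneg assms)
qed (simp add: primal_norm_def)

text \<open>Positive definiteness makes the kernel of B trivial, so s = B w with w =
  \<open>matrix_inv B *v s\<close>. The primal norm of w is the dual norm of s, and Cauchy-Schwarz
  applies to w and v.\<close>

lemma inner_le_dual_primal_norm:
  assumes "spd_matrix B"
  shows "s \<bullet> v \<le> dual_norm B s * primal_norm B v"
proof -
  have "\<forall>u. B *v u = 0 \<longrightarrow> u = 0"
    using assms unfolding spd_matrix_def by (metis inner_zero_left less_irrefl)
  then have "invertible B"
    by (metis invertible_left_inverse matrix_left_invertible_ker)
  then have "B ** matrix_inv B = mat 1"
    unfolding invertible_def matrix_inv_def by (rule someI2_ex) simp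
  then have inv: "B *v (matrix_inv B *v s) = s"
    by (simp add: matrix_vector_mul_assoc)
  then have "primal_norm B (matrix_inv B *v s) = dual_norm B s"
    by (simp add: primal_norm_def dual_norm_def)
  with spd_matrix_Cauchy_Schwarz[OF assms, of "matrix_inv B *v s" v] inv show ?thesis
    by simp
qed

section \<open>Closed convex functions and subgradients\<close>

lemma closed_convex_fun_combination:
  assumes "closed_convex_fun h" "a \<in> eff_dom h" "b \<in> eff_dom h" "0 \<le> t" "t \<le> 1"
  defines "c \<equiv> (1 - t) *\<^sub>R a + t *\<^sub>R b"
  shows "c \<in> eff_dom h"
    and "real_of_ereal (h c) \<le> (1 - t) * real_of_ereal (h a) + t * real_of_ereal (h b)"
proof -
  have fin: "\<bar>h y\<bar> \<noteq> \<infinity>" if "y \<in> eff_dom h" for y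
    using that assms(1) by (auto simp: eff_dom_def closed_convex_fun_def)
  have "(1 - t) *\<^sub>R (a, real_of_ereal (h a)) + t *\<^sub>R (b, real_of_ereal (h b))
      \<in> {(x, r::real). h x \<le> ereal r}"
    using assms(1) fin[OF assms(2)] fin[OF assms(3)] assms(4,5)
    unfolding closed_convex_fun_def
    by (intro convexD) (auto simp: ereal_real)
  then have le: "h c \<le> ereal ((1 - t) * real_of_ereal (h a) + t * real_of_ereal (h b))"
    by (simp add: c_def)
  then show dom: "c \<in> eff_dom h"
    by (auto simp: eff_dom_def)
  show "real_of_ereal (h c) \<le> (1 - t) * real_of_ereal (h a) + t * real_of_ereal (h b)"
    using le fin[OF dom] by (metis ereal_less_eq(3) ereal_real)
qed


lemma subdiffD_real:
  assumes "closed_convex_fun f" "v \<in> subdiff f a" "b \<in> eff_dom f"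
  shows "real_of_ereal (f a) + v \<bullet> (b - a) \<le> real_of_ereal (f b)"
proof -
  have "a \<in> eff_dom f" "f a + ereal (v \<bullet> (b - a)) \<le> f b"
    using assms(2) by (auto simp: subdiff_def)
  moreover have "\<bar>f c\<bar> \<noteq> \<infinity>" if "c \<in> eff_dom f" for c
    using that assms(1) by (auto simp: eff_dom_def closed_convex_fun_def)
  ultimately show ?thesis
    using assms(3) by (metis ereal_less_eq(3) ereal_real plus_ereal.simps(1))
qed

section \<open>Hoelder bound for the Bregman gap\<close>

lemma hoelder_constD:
  assumes "hoelder_const B f S \<nu> < \<infinity>" "a \<in> S" "b \<in> S" "a \<noteq> b"
    "u \<in> subdiff f a" "v \<in> subdiff f b"
  shows "dual_norm B (u - v) / primal_norm B (a - b) powr \<nu> \<le> enn2real (hoelder_const B f S \<nu>)"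
proof -
  have "ennreal (dual_norm B (u - v) / primal_norm B (a - b) powr \<nu>) \<le> hoelder_const B f S \<nu>"
    unfolding hoelder_const_def using assms(2-) by (intro Sup_upper) blast
  also have "\<dots> = ennreal (enn2real (hoelder_const B f S \<nu>))"
    using assms(1) by (simp add: infinity_ennreal_def)
  finally show ?thesis
    by (simp add: ennreal_le_iff)
qed

lemma primal_norm_pos:
  assumes "spd_matrix B" "u \<noteq> 0"
  shows "0 < primal_norm B u"
  using assms by (simp add: primal_norm_def spd_matrix_def)

text \<open>On the segment from x to y, which stays in the convex domain of \<psi>, the subgradients
  paired with y - x act as slopes of f. The Hoelder condition bounds their growth from the slope at
  x, and \<open>hoelder_line_bound\<close> integrates this without differentiability.\<close>

lemma bregman_gap_le_hoelder:
  assumes spd: "spd_matrix B" and f: "closed_convex_fun f" and \<psi>: "closed_convex_fun \<psi>"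
    and dom: "\<And>y. y \<in> eff_dom \<psi> \<Longrightarrow> subdiff f y \<noteq> {}"
    and fin: "hoelder_const B f (eff_dom \<psi>) \<nu> < \<infinity>" and \<nu>: "0 \<le> \<nu>"
    and x: "x \<in> eff_dom \<psi>" and y: "y \<in> eff_dom \<psi>" and g: "g \<in> subdiff f x"
  shows "bregman_gap f g x y \<le>
    enn2real (hoelder_const B f (eff_dom \<psi>) \<nu>) / (1 + \<nu>) * primal_norm B (x - y) powr (1 + \<nu>)"
proof (cases "x = y")
  case True
  then show ?thesis
    using \<nu> by (simp add: bregman_gap_def)
next
  case False
  define L where "L = enn2real (hoelder_const B f (eff_dom \<psi>) \<nu>)"
  define r where "r = primal_norm B (y - x)"
  define z where "z t = (1 - t) *\<^sub>R x + t *\<^sub>R y" for t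
  \<comment> \<open>The gap is formed with the given g, so the slope at 0 must come from g;
    elsewhere any subgradient will do.\<close>
  define G where "G t = (if t = 0 then g else SOME v. v \<in> subdiff f (z t))" for t :: real
  have r: "r > 0"
    unfolding r_def using False by (intro primal_norm_pos spd) simp
  have z: "z t \<in> eff_dom \<psi>" if "t \<in> {0..1}" for t
    unfolding z_def using that by (intro closed_convex_fun_combination(1) \<psi> x y) auto
  have G: "G t \<in> subdiff f (z t)" if "t \<in> {0..1}" for t
    using dom[OF z[OF that]] g by (auto simp: G_def z_def some_in_eq)
  have zf: "z t \<in> eff_dom f" if "t \<in> {0..1}" for t
    using G[OF that] by (simp add: subdiff_def)
  have diff: "z u - z t = (u - t) *\<^sub>R (y - x)" for u t
    by (simp add: z_def algebra_simps)
  have "real_of_ereal (f (z 1)) - real_of_ereal (f (z 0)) - G 0 \<bullet> (y - x)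
      \<le> (L * r powr (1 + \<nu>)) / (1 + \<nu>)"
  proof (rule hoelder_line_bound)
    fix t u :: real assume tu: "t \<in> {0..1}" "u \<in> {0..1}"
    show "real_of_ereal (f (z t)) + G t \<bullet> (y - x) * (u - t) \<le> real_of_ereal (f (z u))"
      using subdiffD_real[OF f G[OF tu(1)] zf[OF tu(2)]] unfolding diff by (simp add: mult.commute)
  next
    fix t :: real assume t: "t \<in> {0<..1}"
    have "z t - z 0 = t *\<^sub>R (y - x)"
      by (simp add: diff)
    then have zt: "z t \<noteq> z 0" and norm: "primal_norm B (z t - z 0) = t * r"
      using t False by (auto simp: primal_norm_scaleR r_def)
    have "dual_norm B (G t - G 0) / (t * r) powr \<nu> \<le> L"
      unfolding L_def norm[symmetric] using t zt by (intro hoelder_constD fin z G) auto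
    then have "dual_norm B (G t - G 0) \<le> L * (t * r) powr \<nu>"
      using t r by (simp add: divide_le_eq)
    then have "dual_norm B (G t - G 0) * r \<le> L * (t * r) powr \<nu> * r"
      using r by (intro mult_right_mono) auto
    also have "\<dots> = L * r powr (1 + \<nu>) * t powr \<nu>"
      using t r by (simp add: powr_mult powr_add)
    finally have "dual_norm B (G t - G 0) * r \<le> L * r powr (1 + \<nu>) * t powr \<nu>" .
    then show "G t \<bullet> (y - x) - G 0 \<bullet> (y - x) \<le> L * r powr (1 + \<nu>) * t powr \<nu>"
      using inner_le_dual_primal_norm[OF spd, of "G t - G 0" "y - x"]
      by (simp add: r_def inner_diff_left)
  qed (use \<nu> in \<open>auto simp: L_def\<close>)
  then show ?thesis
    by (simp add: bregman_gap_def G_def z_def L_def r_def primal_norm_minus_commute)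
qed

text \<open>The subproblem objective is strongly convex with modulus h. Comparing the minimiser a
  with points between a and b, and letting these tend to a, gives the quadratic term with its full
  coefficient.\<close>

lemma prox_inequality:
  assumes spd: "spd_matrix B" and \<psi>: "closed_convex_fun \<psi>"
    and min: "is_arg_min (\<lambda>y. ereal (v \<bullet> y) + \<psi> y + ereal (h / 2 * (primal_norm B (y - c))\<^sup>2))
      (\<lambda>y. y \<in> eff_dom \<psi>) a"
    and b: "b \<in> eff_dom \<psi>" and h: "0 \<le> h"
  shows "v \<bullet> a + real_of_ereal (\<psi> a) + h / 2 * (primal_norm B (a - c))\<^sup>2 + h / 2 * (primal_norm B (b - a))\<^sup>2
    \<le> v \<bullet> b + real_of_ereal (\<psi> b) + h / 2 * (primal_norm B (b - c))\<^sup>2"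
    (is "?A + ?E \<le> ?R")
proof -
  define m where "m y = v \<bullet> y + real_of_ereal (\<psi> y) + h / 2 * (primal_norm B (y - c))\<^sup>2" for y
  have a: "a \<in> eff_dom \<psi>"
    using min by (simp add: is_arg_min_def)
  have m: "ereal (v \<bullet> y) + \<psi> y + ereal (h / 2 * (primal_norm B (y - c))\<^sup>2) = ereal (m y)"
    if "y \<in> eff_dom \<psi>" for y
  proof -
    have "\<psi> y = ereal (real_of_ereal (\<psi> y))"
      using that \<psi> by (auto simp: eff_dom_def closed_convex_fun_def ereal_real)
    then show ?thesis
      unfolding m_def by (metis plus_ereal.simps(1))
  qed
  have shrunk: "m a + h / 2 * (1 - t) * (primal_norm B (b - a))\<^sup>2 \<le> m b" if t: "0 < t" "t < 1" for t
  proof -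
    define z where "z = (1 - t) *\<^sub>R a + t *\<^sub>R b"
    have z: "z \<in> eff_dom \<psi>" "real_of_ereal (\<psi> z) \<le> (1 - t) * real_of_ereal (\<psi> a) + t * real_of_ereal (\<psi> b)"
      unfolding z_def using t by (intro closed_convex_fun_combination \<psi> a b; simp)+
    have zc: "z - c = (1 - t) *\<^sub>R (a - c) + t *\<^sub>R (b - c)"
      by (simp add: z_def algebra_simps)
    have "\<not> ereal (m z) < ereal (m a)"
      using min z(1) a unfolding is_arg_min_def by (metis m)
    then have "m a \<le> m z"
      by simp
    also have "m z \<le> (1 - t) * (v \<bullet> a) + t * (v \<bullet> b)
        + ((1 - t) * real_of_ereal (\<psi> a) + t * real_of_ereal (\<psi> b))
        + h / 2 * ((1 - t) * (primal_norm B (a - c))\<^sup>2 + t * (primal_norm B (b - c))\<^sup>2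
            - t * (1 - t) * (primal_norm B (b - a))\<^sup>2)"
      unfolding m_def zc primal_norm_convex_combination[OF spd] using z(2)
      by (simp add: z_def inner_add_right)
    also have "\<dots> = (1 - t) * m a + t * (m b - h / 2 * (1 - t) * (primal_norm B (b - a))\<^sup>2)"
      by (simp add: m_def algebra_simps add_divide_distrib diff_divide_distrib)
    \<comment> \<open>Cancelling (1 - t) m(a) on both sides leaves a common factor t > 0 to divide
      out.\<close>
    finally have "t * (m a + h / 2 * (1 - t) * (primal_norm B (b - a))\<^sup>2) \<le> t * m b"
      by (simp add: algebra_simps)
    with t show ?thesis
      by simp
  qed
  have "((\<lambda>t. m a + h / 2 * (1 - t) * (primal_norm B (b - a))\<^sup>2)
      \<longlongrightarrow> m a + h / 2 * (1 - 0) * (primal_norm B (b - a))\<^sup>2) (at_right 0)"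
    by (intro tendsto_intros)
  moreover have "\<forall>\<^sub>F t in at_right 0. m a + h / 2 * (1 - t) * (primal_norm B (b - a))\<^sup>2 \<le> m b"
    using shrunk by (auto intro!: eventually_at_rightI[of 0 1])
  ultimately have "m a + h / 2 * (1 - 0) * (primal_norm B (b - a))\<^sup>2 \<le> m b"
    by (intro tendsto_upperbound) auto
  then show ?thesis
    by (simp add: m_def)
qed

section \<open>Growth of the step coefficients\<close>

text \<open>
  The constant is sharp enough only because of the factor \<open>1 / (1 + \<nu>)\<close> in the bound on \<open>\<beta>\<close>. If the
  claim failed at \<open>k + 1\<close>, the increment of \<open>H\<close> would exceed that of the bound; after rescaling
  \<open>r\<^sup>2\<close> to \<open>s = r\<^sup>2 (k + 1) / D\<^sup>2\<close> and with \<open>q = (1 - \<nu>) / 2\<close> this contradicts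
  \<open>s\<^bsup>1-q\<^esup> \<le> (1 - q) s + q\<close>.
\<close>
lemma step_coefficient_bound:
  fixes H r \<beta> :: "nat \<Rightarrow> real" and L \<nu> D :: real
  assumes H0: "H 0 = 0"
    and step: "\<And>k. H (Suc k) = H k + max (\<beta> k - H k * (r k)\<^sup>2 / 2) 0 / (D\<^sup>2 + (r k)\<^sup>2 / 2)"
    and \<beta>: "\<And>k. \<beta> k \<le> L / (1 + \<nu>) * r k powr (1 + \<nu>)"
    and r: "\<And>k. 0 \<le> r k" and D: "0 < D" and L: "0 \<le> L" and \<nu>: "0 \<le> \<nu>" "\<nu> \<le> 1"
  shows "H k \<le> L / D powr (1 - \<nu>) * real k powr ((1 - \<nu>) / 2)"
proof (induction k)
  case 0
  then show ?case
    by (simp add: H0)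
next
  case (Suc k)
  define q where "q = (1 - \<nu>) / 2"
  define m where "m = real (Suc k)"
  define M where "M = L / D powr (1 - \<nu>)"
  \<comment> \<open>Thus a = m^(q-1), and q a is the derivative of t^q at t = m; concavity gives the
    estimate \<open>powr_step\<close>.\<close>
  define a where "a = m powr q / m"
  define s where "s = (r k)\<^sup>2 * m / D\<^sup>2"
  have q: "0 \<le> q" "q \<le> 1 / 2" "\<nu> = 1 - 2 * q" "1 - \<nu> = 2 * q" "1 + \<nu> = 2 * (1 - q)"
    using \<nu> by (auto simp: q_def field_simps)
  have m: "m > 0" and M: "M \<ge> 0" and a: "a > 0" and s: "s \<ge> 0"
    using L D by (auto simp: m_def M_def a_def s_def)
  have IH: "H k \<le> M * real k powr q"
    using Suc by (simp add: M_def q_def)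
  have powr_step: "real k powr q \<le> m powr q - q * a"
  proof -
    have "(real k / m) powr q \<le> q * (real k / m) + (1 - q)"
      using q m by (intro powr_le_affine) auto
    also have "\<dots> = 1 - q / m"
      using m by (simp add: m_def field_simps)
    finally have "(real k / m) powr q * m powr q \<le> (1 - q / m) * m powr q"
      by (intro mult_right_mono) auto
    then show ?thesis
      using m by (simp add: powr_divide a_def algebra_simps)
  qed
  show ?case
  proof (rule ccontr)
    assume "\<not> ?thesis"
    then have gt: "M * m powr q < H (Suc k)"
      by (simp add: M_def m_def q_def not_le)
    have "M * (q * a) \<ge> 0"
      using M q a by simp
    moreover have "H k \<le> M * m powr q - M * (q * a)"
      using IH mult_left_mono[OF powr_step M] by (simp add: algebra_simps)
    ultimately have incr: "M * (q * a) < H (Suc k) - H k" "H k < H (Suc k)"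
      using gt by auto
    have pos: "D\<^sup>2 + (r k)\<^sup>2 / 2 > 0"
      using D by (simp add: add_pos_nonneg)
    \<comment> \<open>A strict increase of H means that the positive part in the update is not
      truncated.\<close>
    have "(H (Suc k) - H k) * (D\<^sup>2 + (r k)\<^sup>2 / 2) = \<beta> k - H k * (r k)\<^sup>2 / 2"
      using incr(2) pos unfolding step[of k] by (auto simp: max_def split: if_splits)
    \<comment> \<open>Moving the r-part of the denominator to the right turns \<open>H k\<close>
      into \<open>H (Suc k)\<close>, for which the assumed failure supplies a lower bound.\<close>
    then have "D\<^sup>2 * (H (Suc k) - H k) = \<beta> k - H (Suc k) * (r k)\<^sup>2 / 2"
      by (simp add: algebra_simps diff_divide_distrib)
    also have "\<dots> \<le> L / (1 + \<nu>) * r k powr (1 + \<nu>) - M * m powr q * (r k)\<^sup>2 / 2"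
      using \<beta>[of k] gt by (intro diff_mono divide_right_mono mult_right_mono) auto
    \<comment> \<open>In terms of s, both remaining terms carry the factor D^2 M a, which leaves an
      inequality in one variable.\<close>
    also have "L / (1 + \<nu>) * r k powr (1 + \<nu>) = D\<^sup>2 * M * a * s powr (1 - q) / (1 + \<nu>)"
    proof (cases "r k = 0")
      case False
      then have rk: "r k > 0"
        using r[of k] by simp
      have "s powr (1 - q) = r k powr (1 + \<nu>) * m powr (1 - q) / D powr (1 + \<nu>)"
        using rk m D by (simp add: s_def powr_mult powr_divide q(5) powr_powr flip: powr_numeral)
      moreover have "D\<^sup>2 * M = L * D powr (1 + \<nu>)"
        using D by (simp add: M_def powr_add powr_diff power2_eq_square field_simps)
      moreover have "a * m powr (1 - q) = 1"
        using m by (simp add: a_def powr_diff)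
      ultimately show ?thesis
        using D by (simp add: field_simps)
    qed (simp add: s_def)
    also have "M * m powr q * (r k)\<^sup>2 / 2 = D\<^sup>2 * M * a * (s / 2)"
      using m D by (simp add: a_def s_def field_simps)
    also have "D\<^sup>2 * M * a * s powr (1 - q) / (1 + \<nu>) - D\<^sup>2 * M * a * (s / 2)
        = D\<^sup>2 * M * a * (s powr (1 - q) / (1 + \<nu>) - s / 2)"
      by (simp add: algebra_simps)
    also have "\<dots> \<le> D\<^sup>2 * M * a * q"
    proof (rule mult_left_mono)
      have "s powr (1 - q) \<le> (1 - q) * s + q"
        using powr_le_affine[of s "1 - q"] s q by simp
      \<comment> \<open>As q is at most 1/2, the factor 2 (1 - q) = 1 + \<nu> is at least 1.\<close>
      moreover have "q * 1 \<le> q * (2 * (1 - q))"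
        using q by (intro mult_left_mono) auto
      ultimately have "s powr (1 - q) \<le> (1 + \<nu>) * (s / 2 + q)"
        unfolding q(5) by (simp add: algebra_simps)
      then show "s powr (1 - q) / (1 + \<nu>) - s / 2 \<le> q"
        using \<nu> by (simp add: divide_le_eq algebra_simps)
    qed (use M a in simp)
    finally have "D\<^sup>2 * (H (Suc k) - H k) \<le> D\<^sup>2 * (M * (q * a))"
      by (simp add: mult_ac)
    with incr(1) D show False
      by simp
  qed
qed


section \<open>The method\<close>

locale line_search_free_method =
  fixes B :: "real^'n^'n"
    and f \<psi> :: "real^'n \<Rightarrow> ereal"
    and D :: real
    and x g :: "nat \<Rightarrow> real^'n"
    and H :: "nat \<Rightarrow> real"
  assumes spd: "spd_matrix B"
    and closed_convex_\<psi>: "closed_convex_fun \<psi>"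
    and closed_convex_f: "closed_convex_fun f"
    and f_finite: "\<And>y. y \<in> eff_dom \<psi> \<Longrightarrow> f y < \<infinity>"
    and f_subdiff: "\<And>y. y \<in> eff_dom \<psi> \<Longrightarrow> subdiff f y \<noteq> {}"
    and D_pos: "D > 0"
    and diam: "\<And>y z. y \<in> eff_dom \<psi> \<Longrightarrow> z \<in> eff_dom \<psi> \<Longrightarrow> primal_norm B (y - z) \<le> D"
    and run: "line_search_free_run B f \<psi> D x g H"
begin

definition F :: "real^'n \<Rightarrow> real" where
  "F y = real_of_ereal (f y) + real_of_ereal (\<psi> y)"

text \<open>Indices are shifted: \<open>r k\<close> and \<open>\<beta> k\<close> belong to the step
  from \<open>x k\<close> to \<open>x (Suc k)\<close>, so they are the quantities that the method
  numbers k + 1.\<close>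

definition r :: "nat \<Rightarrow> real" where
  "r k = primal_norm B (x k - x (Suc k))"

definition \<beta> :: "nat \<Rightarrow> real" where
  "\<beta> k = bregman_gap f (g k) (x k) (x (Suc k))"

lemma H_0: "H 0 = 0"
  and subgradient: "g k \<in> subdiff f (x k)"
  and arg_min: "is_arg_min
    (\<lambda>y. ereal (g k \<bullet> y) + \<psi> y + ereal (H k / 2 * (primal_norm B (y - x k))\<^sup>2))
    (\<lambda>y. y \<in> eff_dom \<psi>) (x (Suc k))"
  and H_Suc: "H (Suc k) = H k + max (\<beta> k - H k * (r k)\<^sup>2 / 2) 0 / (D\<^sup>2 + (r k)\<^sup>2 / 2)"
  using run by (simp_all add: line_search_free_run_def Let_def r_def \<beta>_def)

lemma iterate_in_dom: "x k \<in> eff_dom \<psi>"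
  using run arg_min[of "k - 1"] by (cases k) (auto simp: line_search_free_run_def is_arg_min_def)

lemma denominator_pos: "D\<^sup>2 + (r k)\<^sup>2 / 2 > 0"
  using D_pos by (simp add: add_pos_nonneg)

lemma H_mono: "H k \<le> H (Suc k)"
  unfolding H_Suc[of k] using denominator_pos[of k] by simp

lemma H_nonneg: "0 \<le> H k"
  by (induction k) (use H_0 H_mono order_trans in \<open>auto\<close>)

lemma composite_eq: "y \<in> eff_dom \<psi> \<Longrightarrow> composite f \<psi> y = ereal (F y)"
  using f_finite[of y] closed_convex_f closed_convex_\<psi>
  by (auto simp: composite_def F_def closed_convex_fun_def eff_dom_def ereal_real
      simp flip: plus_ereal.simps(1))

section \<open>One-step descent and telescoping\<close>

lemma squared_distance_le:
  assumes "y \<in> eff_dom \<psi>" "z \<in> eff_dom \<psi>"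
  shows "(primal_norm B (y - z))\<^sup>2 \<le> D\<^sup>2"
  using diam[OF assms] by (intro power_mono primal_norm_nonneg spd)

text \<open>The prox inequality at y and the subgradient inequality for f leave the error \<beta> -
  H r^2 / 2. The update of H is designed so that its increment times the denominator covers this
  error.\<close>

lemma descent_step:
  assumes y: "y \<in> eff_dom \<psi>"
  shows "F (x (Suc k)) - F y + H k / 2 * (primal_norm B (y - x (Suc k)))\<^sup>2
    \<le> H k / 2 * (primal_norm B (y - x k))\<^sup>2 + (H (Suc k) - H k) * (D\<^sup>2 + (r k)\<^sup>2 / 2)"
proof -
  have "real_of_ereal (f (x k)) + g k \<bullet> (y - x k) \<le> real_of_ereal (f y)"
    by (rule subdiffD_real[OF closed_convex_f subgradient])
      (use f_finite[OF y] in \<open>simp add: eff_dom_def\<close>)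
  moreover have "\<beta> k - H k * (r k)\<^sup>2 / 2 \<le> (H (Suc k) - H k) * (D\<^sup>2 + (r k)\<^sup>2 / 2)"
    using denominator_pos[of k] by (simp add: H_Suc)
  moreover have "(primal_norm B (x (Suc k) - x k))\<^sup>2 = (r k)\<^sup>2"
    by (simp add: r_def primal_norm_minus_commute)
  ultimately show ?thesis
    using prox_inequality[OF spd closed_convex_\<psi> arg_min[of k] y H_nonneg[of k]]
    by (simp add: F_def \<beta>_def bregman_gap_def inner_diff_right)
qed

lemma sum_gap_le:
  assumes y: "y \<in> eff_dom \<psi>"
  shows "(\<Sum>i<k. F (x (Suc i)) - F y) + H k / 2 * (primal_norm B (y - x k))\<^sup>2 \<le> 2 * H k * D\<^sup>2"
proof (induction k)
  case 0
  then show ?case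
    by (simp add: H_0)
next
  case (Suc k)
  let ?\<Delta> = "H (Suc k) - H k"
  \<comment> \<open>Raising the coefficient of the squared distance from \<open>H k\<close> to
    \<open>H (Suc k)\<close> costs another D^2 / 2 per unit of increment. With D^2 and r^2 / 2 from
    the descent step this totals at most 2 D^2.\<close>
  have "?\<Delta> * (D\<^sup>2 + (r k)\<^sup>2 / 2 + (primal_norm B (y - x (Suc k)))\<^sup>2 / 2) \<le> ?\<Delta> * (2 * D\<^sup>2)"
    using squared_distance_le[OF y iterate_in_dom[of "Suc k"]] H_mono[of k]
      squared_distance_le[OF iterate_in_dom[of k] iterate_in_dom[of "Suc k"]]
    by (intro mult_left_mono) (auto simp: r_def)
  then show ?case
    using Suc descent_step[OF y, of k] by (simp add: algebra_simps diff_divide_distrib)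
qed

section \<open>Bounds for the best iterate\<close>

lemma best_iterate_in_dom:
  assumes "best_iterate (composite f \<psi>) x k z"
  shows "z \<in> eff_dom \<psi>"
  using assms iterate_in_dom by (auto simp: best_iterate_def is_arg_min_def)

lemma best_iterate_le:
  assumes best: "best_iterate (composite f \<psi>) x k z" and "i < k"
  shows "F z \<le> F (x (Suc i))"
proof -
  have "x (Suc i) \<in> x ` {1..k}"
    using \<open>i < k\<close> by auto
  then have "\<not> composite f \<psi> (x (Suc i)) < composite f \<psi> z"
    using best by (auto simp: best_iterate_def is_arg_min_def)
  then show ?thesis
    by (simp add: composite_eq iterate_in_dom best_iterate_in_dom[OF best])
qed

lemma best_iterate_gap_le_H:
  assumes y: "y \<in> eff_dom \<psi>" and best: "best_iterate (composite f \<psi>) x k z"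
  shows "real k * (F z - F y) \<le> 2 * H k * D\<^sup>2"
proof -
  have "real k * (F z - F y) = (\<Sum>i<k. F z - F y)"
    by simp
  also have "\<dots> \<le> (\<Sum>i<k. F (x (Suc i)) - F y)"
    using best_iterate_le[OF best] by (intro sum_mono diff_right_mono) auto
  also have "\<dots> \<le> 2 * H k * D\<^sup>2"
    using sum_gap_le[OF y, of k] H_nonneg[of k]
    by (smt (verit) divide_nonneg_nonneg mult_nonneg_nonneg zero_le_power2)
  finally show ?thesis .
qed

lemma best_iterate_gap_le_hoelder:
  assumes y: "y \<in> eff_dom \<psi>" and best: "best_iterate (composite f \<psi>) x k z" and k: "k \<ge> 1"
    and \<nu>: "\<nu> \<in> {0..1}" and fin: "hoelder_const B f (eff_dom \<psi>) \<nu> < \<infinity>"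
  defines "L \<equiv> enn2real (hoelder_const B f (eff_dom \<psi>) \<nu>)"
  shows "F z - F y \<le> 2 * L * D powr (1 + \<nu>) / real k powr ((1 + \<nu>) / 2)"
proof -
  have "H k \<le> L / D powr (1 - \<nu>) * real k powr ((1 - \<nu>) / 2)"
  proof (rule step_coefficient_bound[OF H_0 H_Suc])
    show "\<beta> k \<le> L / (1 + \<nu>) * r k powr (1 + \<nu>)" for k
      unfolding \<beta>_def r_def L_def using \<nu>
      by (intro bregman_gap_le_hoelder spd closed_convex_f closed_convex_\<psi> f_subdiff fin
          iterate_in_dom subgradient) auto
  qed (use \<nu> D_pos in \<open>auto simp: L_def r_def primal_norm_nonneg spd\<close>)
  then have "2 * D\<^sup>2 * H k \<le> 2 * D\<^sup>2 * (L / D powr (1 - \<nu>) * real k powr ((1 - \<nu>) / 2))"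
    by (intro mult_left_mono) auto
  with best_iterate_gap_le_H[OF y best]
  have "real k * (F z - F y) \<le> 2 * D\<^sup>2 * (L / D powr (1 - \<nu>) * real k powr ((1 - \<nu>) / 2))"
    by (simp add: mult_ac)
  also have "\<dots> = 2 * L * (D\<^sup>2 / D powr (1 - \<nu>)) * real k powr ((1 - \<nu>) / 2)"
    by simp
  also have "D\<^sup>2 / D powr (1 - \<nu>) = D powr (1 + \<nu>)"
    using D_pos by (simp add: powr_add powr_diff power2_eq_square)
  also have "real k powr ((1 - \<nu>) / 2) = real k powr (1 - (1 + \<nu>) / 2)"
    by (simp add: field_simps)
  also have "\<dots> = real k / real k powr ((1 + \<nu>) / 2)"
    using k by (subst powr_diff) auto
  finally have "real k * (F z - F y) \<le> real k * (2 * L * D powr (1 + \<nu>) / real k powr ((1 + \<nu>) / 2))"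
    by (simp add: mult_ac)
  moreover have "real k > 0"
    using k by simp
  ultimately show ?thesis
    by (simp only: mult_le_cancel_left_pos)
qed

text \<open>The optimal value is an infimum, so z is compared with every y instead of a minimiser.
  The resulting lower bound F(z) - c also excludes the value minus infinity.\<close>

lemma gap_le_if_pointwise:
  assumes z: "z \<in> eff_dom \<psi>" and le: "\<And>y. y \<in> eff_dom \<psi> \<Longrightarrow> F z - F y \<le> c"
  shows "composite f \<psi> z - opt_value f \<psi> \<le> ereal c"
proof -
  have "ereal (F z - c) \<le> opt_value f \<psi>"
    unfolding opt_value_def using le by (intro INF_greatest) (auto simp: composite_eq algebra_simps)
  then have "ereal (F z) - opt_value f \<psi> \<le> ereal c"
    by (cases "opt_value f \<psi>") (auto simp: algebra_simps)
  then show ?thesis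
    by (simp add: composite_eq[OF z])
qed

lemma convergence_rate:
  assumes best: "best_iterate (composite f \<psi>) x k z" and k: "k \<ge> 1"
  shows "composite f \<psi> z - opt_value f \<psi> \<le>
    enn2ereal (INF \<nu>\<in>{0..1}. 2 * hoelder_const B f (eff_dom \<psi>) \<nu> *
       ennreal (D powr (1 + \<nu>)) / ennreal (real k powr ((1 + \<nu>) / 2)))"
proof -
  \<comment> \<open>The infimum lives in \<open>ennreal\<close>, so the gap is moved there;
    \<open>e2ennreal\<close> truncates negative values to 0, which can only enlarge the gap.\<close>
  have "e2ennreal (composite f \<psi> z - opt_value f \<psi>) \<le> 2 * hoelder_const B f (eff_dom \<psi>) \<nu> *
      ennreal (D powr (1 + \<nu>)) / ennreal (real k powr ((1 + \<nu>) / 2))" if \<nu>: "\<nu> \<in> {0..1}" for \<nu>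
  proof (cases "hoelder_const B f (eff_dom \<psi>) \<nu>")
    case (real L)
    have "composite f \<psi> z - opt_value f \<psi> \<le>
        ereal (2 * L * D powr (1 + \<nu>) / real k powr ((1 + \<nu>) / 2))"
      using best_iterate_gap_le_hoelder[OF _ best k \<nu>] real
      by (intro gap_le_if_pointwise best_iterate_in_dom[OF best]) (auto simp: less_top[symmetric])
    then have "e2ennreal (composite f \<psi> z - opt_value f \<psi>) \<le>
        ennreal (2 * L * D powr (1 + \<nu>) / real k powr ((1 + \<nu>) / 2))"
      by (metis e2ennreal_mono e2ennreal_ereal)
    also have "\<dots> = 2 * hoelder_const B f (eff_dom \<psi>) \<nu> *
        ennreal (D powr (1 + \<nu>)) / ennreal (real k powr ((1 + \<nu>) / 2))"
    proof -
      have "2 * hoelder_const B f (eff_dom \<psi>) \<nu> * ennreal (D powr (1 + \<nu>)) = ennreal (2 * L * D powr (1 + \<nu>))"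
        using real by (simp add: ennreal_mult)
      then show ?thesis
        using real(1) k by (simp add: divide_ennreal)
    qed
    finally show ?thesis .
  next
    case top
    \<comment> \<open>An infinite Hoelder constant keeps its term infinite, because D is positive
      and the divisor is finite.\<close>
    then show ?thesis
      using D_pos k by (simp add: ennreal_mult_top ennreal_top_mult ennreal_top_divide)
  qed
  then have "e2ennreal (composite f \<psi> z - opt_value f \<psi>) \<le>
      (INF \<nu>\<in>{0..1}. 2 * hoelder_const B f (eff_dom \<psi>) \<nu> *
       ennreal (D powr (1 + \<nu>)) / ennreal (real k powr ((1 + \<nu>) / 2)))"
    by (rule INF_greatest)
  moreover have "c \<le> enn2ereal (e2ennreal c)" for c
    by (cases "0 \<le> c") (auto simp: enn2ereal_e2ennreal intro: order_trans[OF _ enn2ereal_nonneg])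
  ultimately show ?thesis
    unfolding less_eq_ennreal.rep_eq by (rule order_trans[rotated])
qed

text \<open>
  The infimum over \<open>\<nu>\<close> need not be attained: a gap \<open>\<delta> > \<epsilon>\<close> forces every term to be at least
  \<open>k \<delta> / \<epsilon>\<close>, hence the infimum to exceed \<open>k\<close> strictly.
\<close>
lemma complexity_bound:
  assumes best: "best_iterate (composite f \<psi>) x k z" and k: "k \<ge> 1" and \<epsilon>: "\<epsilon> > 0"
    and le: "(INF \<nu>\<in>{0..1}. ennreal_powr (2 * hoelder_const B f (eff_dom \<psi>) \<nu> / ennreal \<epsilon>)
      (2 / (1 + \<nu>)) * ennreal (D\<^sup>2)) \<le> of_nat k"
  shows "composite f \<psi> z - opt_value f \<psi> \<le> ereal \<epsilon>"
proof (rule gap_le_if_pointwise[OF best_iterate_in_dom[OF best]], rule ccontr)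
  fix y assume y: "y \<in> eff_dom \<psi>" and "\<not> F z - F y \<le> \<epsilon>"
  then have \<delta>: "\<epsilon> < F z - F y"
    by simp
  define \<delta> where "\<delta> = F z - F y"
  have "ennreal (real k * (\<delta> / \<epsilon>)) \<le> ennreal_powr (2 * hoelder_const B f (eff_dom \<psi>) \<nu> / ennreal \<epsilon>)
      (2 / (1 + \<nu>)) * ennreal (D\<^sup>2)" if \<nu>: "\<nu> \<in> {0..1}" for \<nu>
  proof (cases "hoelder_const B f (eff_dom \<psi>) \<nu>")
    case (real L)
    \<comment> \<open>Raising the rate bound to the power p turns k^(1/p) into k and D^(2/p) into
      D^2.\<close>
    define p where "p = 2 / (1 + \<nu>)"
    have p: "p \<ge> 1" "(1 + \<nu>) / 2 = 1 / p" "1 + \<nu> = 2 / p"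
      using \<nu> by (auto simp: p_def)
    have "\<delta> \<le> 2 * L * D powr (1 + \<nu>) / real k powr ((1 + \<nu>) / 2)"
      using best_iterate_gap_le_hoelder[OF y best k \<nu>] real by (simp add: less_top[symmetric] \<delta>_def)
    then have "\<delta> / \<epsilon> * real k powr (1 / p) \<le> 2 * L / \<epsilon> * D powr (2 / p)"
      using k \<epsilon> unfolding p(2,3) by (simp add: field_simps)
    then have "(\<delta> / \<epsilon> * real k powr (1 / p)) powr p \<le> (2 * L / \<epsilon> * D powr (2 / p)) powr p"
      using p \<delta> \<epsilon> by (intro powr_mono2) (auto simp: \<delta>_def)
    also have "\<dots> = (2 * L / \<epsilon>) powr p * D\<^sup>2"
      using p real \<epsilon> D_pos by (subst powr_mult) (auto simp: powr_powr)
    also have "(\<delta> / \<epsilon> * real k powr (1 / p)) powr p = (\<delta> / \<epsilon>) powr p * real k"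
      using p by (subst powr_mult) (simp_all add: powr_powr)
    finally have "(\<delta> / \<epsilon>) powr p * real k \<le> (2 * L / \<epsilon>) powr p * D\<^sup>2" .
    \<comment> \<open>Since \<delta> / \<epsilon> > 1 and p is at least 1, dropping the exponent
      gives a lower bound that does not depend on \<nu> and hence survives the infimum.\<close>
    moreover have "\<delta> / \<epsilon> \<le> (\<delta> / \<epsilon>) powr p"
      using powr_mono[of 1 p "\<delta> / \<epsilon>"] p \<delta> \<epsilon> by (simp add: \<delta>_def)
    ultimately have "real k * (\<delta> / \<epsilon>) \<le> (2 * L / \<epsilon>) powr p * D\<^sup>2"
      using mult_left_mono[of "\<delta> / \<epsilon>" "(\<delta> / \<epsilon>) powr p" "real k"] by (simp add: mult.commute)
    then have "ennreal (real k * (\<delta> / \<epsilon>)) \<le> ennreal ((2 * L / \<epsilon>) powr p * D\<^sup>2)"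
      by (rule ennreal_leI)
    also have "\<dots> = ennreal_powr (2 * hoelder_const B f (eff_dom \<psi>) \<nu> / ennreal \<epsilon>) p * ennreal (D\<^sup>2)"
    proof -
      have "2 * hoelder_const B f (eff_dom \<psi>) \<nu> / ennreal \<epsilon> = ennreal (2 * L / \<epsilon>)"
        using real \<epsilon> by (simp add: ennreal_mult divide_ennreal[symmetric])
      then show ?thesis
        using real \<epsilon> by (simp add: ennreal_powr_def ennreal_mult)
    qed
    finally show ?thesis
      by (simp add: p_def)
  next
    case top
    then show ?thesis
      using D_pos \<epsilon> by (simp add: ennreal_powr_def ennreal_mult_top ennreal_top_mult ennreal_top_divide)
  qed
  then have "ennreal (real k * (\<delta> / \<epsilon>)) \<le> (INF \<nu>\<in>{0..1}.
      ennreal_powr (2 * hoelder_const B f (eff_dom \<psi>) \<nu> / ennreal \<epsilon>) (2 / (1 + \<nu>)) * ennreal (D\<^sup>2))"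
    by (rule INF_greatest)
  also note le
  finally have "real k * (\<delta> / \<epsilon>) \<le> real k"
    by (simp add: ennreal_of_nat_eq_real_of_nat)
  then have "\<delta> / \<epsilon> \<le> 1"
    using k mult_le_cancel_left_pos[of "real k" "\<delta> / \<epsilon>" 1] by simp
  with \<delta> \<epsilon> show False
    by (simp add: \<delta>_def)
qed

end

theorem theorem3p1:
  fixes B :: "real^'n^'n"
    and f \<psi> :: "real^'n \<Rightarrow> ereal"
    and D :: real
    and x g :: "nat \<Rightarrow> real^'n"
    and H :: "nat \<Rightarrow> real"
  assumes "spd_matrix B"
    and "proper_fun \<psi>" and "closed_convex_fun \<psi>"
    and "closed_convex_fun f"
    and "\<exists>U. open U \<and> eff_dom \<psi> \<subseteq> U \<and> (\<forall>y\<in>U. f y < \<infinity> \<and> subdiff f y \<noteq> {})"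
    and "D > 0"
    and "\<forall>y\<in>eff_dom \<psi>. \<forall>z\<in>eff_dom \<psi>. primal_norm B (y - z) \<le> D"
    and "\<exists>\<nu>\<in>{0..1}. hoelder_const B f (eff_dom \<psi>) \<nu> < \<infinity>"
    and "line_search_free_run B f \<psi> D x g H"
  shows "(\<forall>k\<ge>1. \<forall>z. best_iterate (composite f \<psi>) x k z \<longrightarrow>
            composite f \<psi> z - opt_value f \<psi> \<le>
              enn2ereal (INF \<nu>\<in>{0..1}. 2 * hoelder_const B f (eff_dom \<psi>) \<nu> *
                 ennreal (D powr (1 + \<nu>)) / ennreal (real k powr ((1 + \<nu>) / 2))))
       \<and> (\<forall>\<epsilon>::real. \<epsilon> > 0 \<longrightarrow>
           (\<forall>k\<ge>1. \<forall>z. best_iterate (composite f \<psi>) x k z \<longrightarrow>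
              (INF \<nu>\<in>{0..1}. ennreal_powr (2 * hoelder_const B f (eff_dom \<psi>) \<nu> / ennreal \<epsilon>)
                                 (2 / (1 + \<nu>)) * ennreal (D\<^sup>2)) \<le> of_nat k \<longrightarrow>
              composite f \<psi> z - opt_value f \<psi> \<le> ereal \<epsilon>))"
proof -
  interpret line_search_free_method B f \<psi> D x g H
    using assms by unfold_locales auto
  show ?thesis
    using convergence_rate complexity_bound by blast
qed

end
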